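(* Let $\mathcal{G}$ be a finite simple connected graph and let $n\ge3$. The Attracting Random Walks (ARW) Markov chain with $n$ particles on $\mathcal{G}$ is reversible for all $\beta\in\mathbb{R}$ if and only if $\mathcal{G}$ is a complete graph.
   Context: ARW chain: let $\mathcal{G}=(\mathcal{V},\mathcal{E})$ be a finite simple connected graph with $k=|\mathcal{V}|$ vertices; write $i\sim j$ if $(i,j)\in\mathcal{E}$. For $n\ge1$ the state space is $\Omega=\{x\in\mathbb{Z}_{\ge0}^{\mathcal{V}}:\sum_i x(i)=n\}$ ($x(i)$ is the number of indistinguishable particles at vertex $i$). For $\beta\in\mathbb{R}$, one step from $x$ is: choose one of the $n$ particles uniformly at random, say located at $i$; move it to a neighbor $j\sim i$ with probability $\frac1Z\exp(\frac{\beta}{n}x(j))$, or keep it at $i$ with probability $\frac1Z\exp(\frac{\beta}{n}(x(i)-1))$, where $Z=\sum_{l\sim i}\exp(\frac{\beta}{n}x(l))+\exp(\frac{\beta}{n}(x(i)-1))$. Let $P$ be the transition matrix and $\pi$ its stationary distribution. Reversible means $\pi(x)P(x,y)=\pi(y)P(y,x)$ for all $x,y\in\Omega$. *)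

theory Defs
  imports Complex_Main "Graph_Theory.Graph_Theory"
begin

definition stationary_distribution ::
    "'s set \<Rightarrow> ('s \<Rightarrow> 's \<Rightarrow> real) \<Rightarrow> ('s \<Rightarrow> real) \<Rightarrow> bool" where
  "stationary_distribution S P \<pi> \<longleftrightarrow>
     (\<forall>x\<in>S. 0 \<le> \<pi> x) \<and> (\<Sum>x\<in>S. \<pi> x) = 1 \<and>
     (\<forall>y\<in>S. (\<Sum>x\<in>S. \<pi> x * P x y) = \<pi> y)"

text \<open>The stationary distribution of an irreducible chain is unique, so for such chains
  the witness below is necessarily the stationary distribution.\<close>

definition reversible_chain :: "'s set \<Rightarrow> ('s \<Rightarrow> 's \<Rightarrow> real) \<Rightarrow> bool" where
  "reversible_chain S P \<longleftrightarrow>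
     (\<exists>\<pi>. stationary_distribution S P \<pi> \<and>
          (\<forall>x\<in>S. \<forall>y\<in>S. \<pi> x * P x y = \<pi> y * P y x))"

text \<open>Configurations are extended by 0 outside the vertex set, so that equal
  configurations are equal functions.\<close>

definition arw_states :: "('a, 'b) pre_digraph \<Rightarrow> nat \<Rightarrow> ('a \<Rightarrow> nat) set" where
  "arw_states G n = {x. (\<forall>v. v \<notin> verts G \<longrightarrow> x v = 0) \<and> (\<Sum>v\<in>verts G. x v) = n}"

definition arw_Z :: "('a, 'b) pre_digraph \<Rightarrow> nat \<Rightarrow> real \<Rightarrow> ('a \<Rightarrow> nat) \<Rightarrow> 'a \<Rightarrow> real" where
  "arw_Z G n \<beta> x i =
     (\<Sum>l\<in>{l. i \<rightarrow>\<^bsub>G\<^esub> l}. exp (\<beta> / real n * real (x l))) + exp (\<beta> / real n * (real (x i) - 1))"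

definition arw_jump ::
    "('a, 'b) pre_digraph \<Rightarrow> nat \<Rightarrow> real \<Rightarrow> ('a \<Rightarrow> nat) \<Rightarrow> 'a \<Rightarrow> 'a \<Rightarrow> real" where
  "arw_jump G n \<beta> x i j =
     (if j = i then exp (\<beta> / real n * (real (x i) - 1)) / arw_Z G n \<beta> x i
      else if i \<rightarrow>\<^bsub>G\<^esub> j then exp (\<beta> / real n * real (x j)) / arw_Z G n \<beta> x i
      else 0)"

text \<open>The particle is removed before it is added back, so that moving it from \<open>i\<close> to \<open>i\<close>
  leaves \<open>x\<close> unchanged whenever \<open>x i > 0\<close>.\<close>

definition arw_move :: "('a \<Rightarrow> nat) \<Rightarrow> 'a \<Rightarrow> 'a \<Rightarrow> ('a \<Rightarrow> nat)" where
  "arw_move x i j = (let x' = x(i := x i - 1) in x'(j := x' j + 1))"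

text \<open>A uniformly chosen particle is located at \<open>i\<close> with probability \<open>x i / n\<close>; in particular
  empty sites contribute nothing.\<close>

definition arw_P ::
    "('a, 'b) pre_digraph \<Rightarrow> nat \<Rightarrow> real \<Rightarrow> ('a \<Rightarrow> nat) \<Rightarrow> ('a \<Rightarrow> nat) \<Rightarrow> real" where
  "arw_P G n \<beta> x y =
     (\<Sum>i\<in>verts G. real (x i) / real n *
        (\<Sum>j\<in>{j\<in>verts G. arw_move x i j = y}. arw_jump G n \<beta> x i j))"

end

theory Submission
  imports Defs
begin

text \<open>Put \<open>q = exp (\<beta> / n)\<close> and let \<open>Z\<^sub>i z\<close> be the sum of \<open>q ^ z l\<close> over the closed neighbourhood of
  \<open>i\<close>.  With \<open>W x = (\<Prod>v. q ^ (x v choose 2) / fact (x v))\<close> the flow \<open>W (z + e\<^sub>i) * P (z + e\<^sub>i) (z + e\<^sub>j)\<close> is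
  symmetric in \<open>i\<close> and \<open>j\<close> up to the factor \<open>1 / Z\<^sub>i z\<close>.  In a complete graph \<open>Z\<^sub>i z\<close> does not depend
  on \<open>i\<close>, so \<open>W\<close> is reversible.

  A connected graph that is not complete has an induced path \<open>a - b - c\<close>.  Put all but two of the
  particles at \<open>a\<close> and let the other two go around the square made of the commuting moves
  \<open>a \<rightarrow> b\<close> and \<open>b \<rightarrow> c\<close>.  Kolmogorov's cycle condition on this square is violated for
  large \<open>q\<close>; at least one particle remaining at \<open>a\<close> is where \<open>n \<ge> 3\<close> enters.\<close>

section \<open>Adding one particle to a configuration\<close>

text \<open>Every possible transition has the form \<open>incr i z\<close> to
  \<open>incr j z\<close>, where \<open>z\<close> is what remains when the chosen particle is taken
  out. Working with \<open>z\<close> avoids truncated subtraction.\<close>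

definition incr :: "'a \<Rightarrow> ('a \<Rightarrow> nat) \<Rightarrow> 'a \<Rightarrow> nat" where
  "incr i z = z(i := Suc (z i))"

lemma incr_apply: "incr i z v = (if v = i then Suc (z v) else z v)"
  by (simp add: incr_def)

lemma incr_commute: "incr i (incr j z) = incr j (incr i z)"
  by (auto simp: incr_def fun_eq_iff)

lemma incr_eq_incr_iff: "incr i z = incr j z \<longleftrightarrow> i = j"
  by (metis incr_apply n_not_Suc_n)

lemma incr_decr: "0 < x i \<Longrightarrow> incr i (x(i := x i - Suc 0)) = x"
  by (simp add: incr_def)

lemma arw_move_conv: "arw_move x i j = incr j (x(i := x i - 1))"
  by (simp add: arw_move_def incr_def Let_def)

lemma arw_move_incr: "arw_move (incr i z) i j = incr j z"
  by (simp add: arw_move_conv) (simp add: incr_def)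

text \<open>At \<open>i\<close> the count has to drop from \<open>Suc (z i)\<close> to
  \<open>z i\<close>, which only a departure from \<open>i\<close> achieves; the target is then
  determined by the result.\<close>

lemma arw_move_eq_incr_iff:
  assumes "i \<noteq> j" "0 < incr i z i'"
  shows "arw_move (incr i z) i' j' = incr j z \<longleftrightarrow> i' = i \<and> j' = j"
proof
  assume eq: "arw_move (incr i z) i' j' = incr j z"
  have "i' = i"
    using fun_cong[OF eq, of i] assms
    by (auto simp: arw_move_conv incr_apply split: if_splits)
  moreover from this have "j' = j"
    using eq by (simp add: arw_move_incr incr_eq_incr_iff)
  ultimately show "i' = i \<and> j' = j" ..
qed (simp add: arw_move_incr)

section \<open>Weights and local partition functions\<close>

text \<open>The inner product equals \<open>q ^ (x v choose 2) / fact (x v)\<close>; in this form a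
  new particle contributes a single factor.\<close>

definition weight :: "'a set \<Rightarrow> real \<Rightarrow> ('a \<Rightarrow> nat) \<Rightarrow> real" where
  "weight V q x = (\<Prod>v\<in>V. \<Prod>m<x v. q ^ m / real (Suc m))"

lemma weight_pos: "0 < q \<Longrightarrow> 0 < weight V q x"
  by (auto simp: weight_def intro!: prod_pos)

lemma weight_incr:
  assumes "finite V" "i \<in> V"
  shows "weight V q (incr i z) = weight V q z * (q ^ z i / real (Suc (z i)))"
proof -
  have "weight V q x = (\<Prod>m<x i. q ^ m / real (Suc m)) * weight (V - {i}) q x" for x
    using assms by (simp add: weight_def prod.remove)
  moreover have "weight (V - {i}) q (incr i z) = weight (V - {i}) q z"
    by (auto simp: weight_def incr_apply intro!: prod.cong)
  ultimately show ?thesis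
    by (simp add: incr_apply)
qed

text \<open>Since \<open>z\<close> lacks the moving particle, the exponent \<open>x i - 1\<close>
  for staying becomes \<open>z i\<close>, so \<open>i\<close> enters the sum like any
  neighbour.\<close>

definition local_Z :: "('a, 'b) pre_digraph \<Rightarrow> real \<Rightarrow> ('a \<Rightarrow> nat) \<Rightarrow> 'a \<Rightarrow> real" where
  "local_Z G q z i = (\<Sum>l\<in>insert i {l. i \<rightarrow>\<^bsub>G\<^esub> l}. q ^ z l)"

lemma exp_mult_real_nat: "exp (t * real k) = exp t ^ k"
  by (metis exp_of_nat_mult mult.commute)

lemma arw_states_0: "finite (verts G) \<Longrightarrow> x \<in> arw_states G 0 \<Longrightarrow> x = (\<lambda>_. 0)"
  by (auto simp: arw_states_def)

text \<open>Here \<open>A\<close>, \<open>B\<close>, \<open>C\<close> stand for \<open>Z\<^sub>a\<close>, \<open>Z\<^sub>b\<close>, \<open>Z\<^sub>c\<close> and \<open>\<alpha>\<close> for \<open>q ^ (n - 2)\<close>; the two sides are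
  those of the cycle condition.\<close>

lemma cycle_inequality:
  fixes A B C q \<alpha> :: real
  assumes "1 < q" "q \<le> \<alpha>" "0 < B" "0 < C" "C \<le> q" "\<alpha> \<le> A"
  shows "(A + (q - 1)) * (B + (q - 1)) * C < (C + (q - 1)) * A * (B + (q - 1) * \<alpha>)"
proof -
  have A: "C \<le> A" "1 < A" using assms by linarith+
  \<comment> \<open>The difference of the two sides is \<open>q - 1\<close> times the sum of three
    terms. They are bounded one by one, with strictness coming from this one.\<close>
  have "0 < A * C * (\<alpha> - 1)" using assms A by (intro mult_pos_pos) linarith+
  moreover have "0 \<le> B * (A - C)" using assms A by simp
  moreover have "0 \<le> (q - 1) * (\<alpha> * A - C)"
  proof -
    have "1 * A \<le> \<alpha> * A" using assms A by (intro mult_right_mono) linarith+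
    then show ?thesis using assms A by (intro mult_nonneg_nonneg) linarith+
  qed
  ultimately have "0 < (q - 1) * (A * C * (\<alpha> - 1) + B * (A - C) + (q - 1) * (\<alpha> * A - C))"
    using assms by (intro mult_pos_pos) linarith+
  also have "\<dots> = (C + (q - 1)) * A * (B + (q - 1) * \<alpha>) - (A + (q - 1)) * (B + (q - 1)) * C"
    by (simp add: algebra_simps)
  finally show ?thesis by simp
qed

context graph
begin

section \<open>The state space\<close>

lemma finite_neighbours: "finite {l. i \<rightarrow>\<^bsub>G\<^esub> l}"
  by (rule finite_subset[OF _ finite_verts]) (auto dest: adj_in_verts)

lemma finite_arw_states: "finite (arw_states G n)"
proof (rule finite_subset)
  show "arw_states G n \<subseteq> {x. \<forall>v. (v \<in> verts G \<longrightarrow> x v \<in> {..n}) \<and> (v \<notin> verts G \<longrightarrow> x v = 0)}"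
    by (auto simp: arw_states_def intro: member_le_sum)
  show "finite \<dots>"
    by (rule finite_set_of_finite_funs) auto
qed

lemma sum_incr: "i \<in> verts G \<Longrightarrow> (\<Sum>v\<in>verts G. incr i z v) = Suc (\<Sum>v\<in>verts G. z v)"
  by (simp add: sum.remove[of _ i] incr_apply)

lemma incr_in_arw_states_iff:
  "i \<in> verts G \<Longrightarrow> incr i z \<in> arw_states G (Suc n) \<longleftrightarrow> z \<in> arw_states G n"
proof -
  assume i: "i \<in> verts G"
  then have "(\<forall>v. v \<notin> verts G \<longrightarrow> incr i z v = 0) \<longleftrightarrow> (\<forall>v. v \<notin> verts G \<longrightarrow> z v = 0)"
    by (auto simp: incr_apply)
  with i show ?thesis by (simp add: arw_states_def sum_incr)
qed

lemma arw_statesE: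
  assumes "x \<in> arw_states G (Suc n)"
  obtains i z where "i \<in> verts G" "z \<in> arw_states G n" "x = incr i z"
proof -
  have "(\<Sum>v\<in>verts G. x v) \<noteq> 0"
    using assms by (simp add: arw_states_def)
  then obtain i where i: "i \<in> verts G" "0 < x i"
    by (metis not_gr_zero sum.neutral)
  then have eq: "x = incr i (x(i := x i - 1))"
    by (simp add: incr_decr)
  then have "x(i := x i - 1) \<in> arw_states G n"
    using assms i incr_in_arw_states_iff by metis
  with i eq show thesis by (blast intro: that)
qed

lemma arw_states_nonempty: "verts G \<noteq> {} \<Longrightarrow> arw_states G n \<noteq> {}"
proof (induction n)
  case 0
  have "(\<lambda>_. 0) \<in> arw_states G 0" by (simp add: arw_states_def)
  then show ?case by blast
next
  case (Suc n)
  then obtain i z where "i \<in> verts G" "z \<in> arw_states G n" by blast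
  then have "incr i z \<in> arw_states G (Suc n)" by (simp add: incr_in_arw_states_iff)
  then show ?case by blast
qed

text \<open>Any state can be turned into any other by relocating particles one at a time. In the
  induction one particle of \<open>x\<close> is held at \<open>i\<close> while the others are
  rearranged from \<open>z\<close> to \<open>z'\<close>; then it is moved to
  \<open>j\<close>.\<close>

lemma arw_states_constant:
  assumes "\<And>z i j. z \<in> arw_states G n \<Longrightarrow> i \<in> verts G \<Longrightarrow> j \<in> verts G \<Longrightarrow>
      f (incr i z) = f (incr j z)"
    and "x \<in> arw_states G (Suc n)" "y \<in> arw_states G (Suc n)"
  shows "f x = f y"
  using assms
proof (induction n arbitrary: f x y)
  case 0
  obtain i z where x: "i \<in> verts G" "z \<in> arw_states G 0" "x = incr i z"
    using 0(2) by (rule arw_statesE)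
  obtain j z' where y: "j \<in> verts G" "z' \<in> arw_states G 0" "y = incr j z'"
    using 0(3) by (rule arw_statesE)
  have "z' = z" using arw_states_0[OF finite_verts x(2)] arw_states_0[OF finite_verts y(2)] by simp
  with x y 0(1) show ?case by blast
next
  case (Suc n)
  obtain i z where x: "i \<in> verts G" "z \<in> arw_states G (Suc n)" "x = incr i z"
    using Suc.prems(2) by (rule arw_statesE)
  obtain j z' where y: "j \<in> verts G" "z' \<in> arw_states G (Suc n)" "y = incr j z'"
    using Suc.prems(3) by (rule arw_statesE)
  have "f (incr i z) = f (incr i z')"
  proof (rule Suc.IH[of "\<lambda>w. f (incr i w)"])
    fix w k l assume w: "w \<in> arw_states G n" "k \<in> verts G" "l \<in> verts G"
    then have "incr i w \<in> arw_states G (Suc n)"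
      using x by (simp add: incr_in_arw_states_iff)
    then show "f (incr i (incr k w)) = f (incr i (incr l w))"
      unfolding incr_commute[of i] by (rule Suc.prems(1)) (use w in auto)
  qed (use x y in auto)
  also have "\<dots> = f (incr j z')"
    using Suc.prems(1) x y by blast
  finally show ?case using x y by simp
qed

section \<open>Transition probabilities\<close>

lemma local_Z_pos: "0 < q \<Longrightarrow> 0 < local_Z G q z i"
  unfolding local_Z_def by (rule sum_pos) (auto simp: finite_neighbours)

lemma local_Z_incr:
  "local_Z G q (incr k z) i =
     local_Z G q z i + (if k = i \<or> i \<rightarrow>\<^bsub>G\<^esub> k then (q - 1) * q ^ z k else 0)"
proof -
  have "local_Z G q (incr k z) i =
      (\<Sum>l\<in>insert i {l. i \<rightarrow>\<^bsub>G\<^esub> l}. q ^ z l + (if l = k then (q - 1) * q ^ z k else 0))"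
    unfolding local_Z_def by (rule sum.cong) (auto simp: incr_apply algebra_simps)
  also have "\<dots> = local_Z G q z i +
      (\<Sum>l\<in>insert i {l. i \<rightarrow>\<^bsub>G\<^esub> l}. if l = k then (q - 1) * q ^ z k else 0)"
    by (simp only: sum.distrib local_Z_def)
  also have "(\<Sum>l\<in>insert i {l. i \<rightarrow>\<^bsub>G\<^esub> l}. if l = k then (q - 1) * q ^ z k else 0) =
      (if k \<in> insert i {l. i \<rightarrow>\<^bsub>G\<^esub> l} then (q - 1) * q ^ z k else 0)"
    by (rule sum.delta) (simp add: finite_neighbours)
  finally show ?thesis by simp
qed

lemma arw_Z_incr: "arw_Z G n \<beta> (incr i z) i = local_Z G (exp (\<beta> / real n)) z i"
proof -
  have "i \<notin> {l. i \<rightarrow>\<^bsub>G\<^esub> l}"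
    using adj_not_same by auto
  moreover have "(\<Sum>l\<in>{l. i \<rightarrow>\<^bsub>G\<^esub> l}. exp (\<beta> / real n * real (incr i z l))) =
      (\<Sum>l\<in>{l. i \<rightarrow>\<^bsub>G\<^esub> l}. exp (\<beta> / real n) ^ z l)"
    using calculation by (intro sum.cong refl) (auto simp: incr_apply exp_mult_real_nat[symmetric])
  moreover have "exp (\<beta> / real n * (real (incr i z i) - 1)) = exp (\<beta> / real n) ^ z i"
    by (simp add: incr_apply exp_mult_real_nat[symmetric])
  ultimately show ?thesis
    by (simp add: arw_Z_def local_Z_def finite_neighbours)
qed

lemma arw_Z_pos: "0 < arw_Z G n \<beta> x i"
  unfolding arw_Z_def by (intro add_nonneg_pos sum_nonneg) auto

lemma sum_arw_jump:
  assumes "i \<in> verts G"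
  shows "(\<Sum>j\<in>verts G. arw_jump G n \<beta> x i j) = 1"
proof -
  have sub: "{l. i \<rightarrow>\<^bsub>G\<^esub> l} \<subseteq> verts G - {i}"
    using adj_in_verts adj_not_same by blast
  have "(\<Sum>j\<in>verts G - {i}. arw_jump G n \<beta> x i j) =
      (\<Sum>j\<in>{l. i \<rightarrow>\<^bsub>G\<^esub> l}. exp (\<beta> / real n * real (x j)) / arw_Z G n \<beta> x i)"
    using sub by (intro sum.mono_neutral_cong_right) (auto simp: arw_jump_def)
  then have "(\<Sum>j\<in>verts G. arw_jump G n \<beta> x i j) = arw_Z G n \<beta> x i / arw_Z G n \<beta> x i"
    using assms
    by (simp add: sum.remove arw_jump_def sum_divide_distrib[symmetric] add_divide_distrib[symmetric])
       (simp add: arw_Z_def add.commute)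
  then show ?thesis
    using arw_Z_pos[of n \<beta> x i] by simp
qed

text \<open>Row sums equal to 1 turn detailed balance into stationarity.\<close>

lemma sum_arw_P:
  assumes "x \<in> arw_states G n" "0 < n"
  shows "(\<Sum>y\<in>arw_states G n. arw_P G n \<beta> x y) = 1"
proof -
  have move: "arw_move x i j \<in> arw_states G n" if "i \<in> verts G" "j \<in> verts G" "0 < x i" for i j
  proof -
    obtain m where m: "n = Suc m" using assms(2) gr0_implies_Suc by blast
    have "x(i := x i - 1) \<in> arw_states G m"
      using assms(1) that incr_in_arw_states_iff[of i "x(i := x i - 1)" m]
      by (simp add: incr_decr m)
    then show ?thesis
      using that by (simp add: arw_move_conv incr_in_arw_states_iff m)
  qed
  have "(\<Sum>y\<in>arw_states G n. arw_P G n \<beta> x y) =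
      (\<Sum>i\<in>verts G. real (x i) / real n *
        (\<Sum>y\<in>arw_states G n. \<Sum>j\<in>{j\<in>verts G. arw_move x i j = y}. arw_jump G n \<beta> x i j))"
    unfolding arw_P_def by (subst sum.swap) (simp add: sum_distrib_left)
  also have "\<dots> = (\<Sum>i\<in>verts G. real (x i) / real n)"
  proof (rule sum.cong)
    fix i assume i: "i \<in> verts G"
    show "real (x i) / real n *
        (\<Sum>y\<in>arw_states G n. \<Sum>j\<in>{j\<in>verts G. arw_move x i j = y}. arw_jump G n \<beta> x i j) =
        real (x i) / real n"
    \<comment> \<open>A move from an empty site would create a particle and leave the state space;
      its coefficient is 0, so targets are grouped only for occupied sites.\<close>
    proof (cases "x i = 0")
      case False
      then have "(\<Sum>y\<in>arw_states G n. \<Sum>j\<in>{j\<in>verts G. arw_move x i j = y}. arw_jump G n \<beta> x i j)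
          = (\<Sum>j\<in>verts G. arw_jump G n \<beta> x i j)"
        using move i by (intro sum.group finite_verts finite_arw_states) auto
      then show ?thesis by (simp add: sum_arw_jump i)
    qed simp
  qed simp
  also have "\<dots> = 1"
    using assms by (simp add: sum_divide_distrib[symmetric] of_nat_sum[symmetric] arw_states_def)
  finally show ?thesis .
qed

lemma arw_P_nonzeroE:
  assumes "arw_P G n \<beta> x y \<noteq> 0"
  obtains i j z where "i \<in> verts G" "j \<in> verts G" "x = incr i z" "y = incr j z"
proof -
  obtain i where i: "i \<in> verts G" "0 < x i"
    and "(\<Sum>j\<in>{j\<in>verts G. arw_move x i j = y}. arw_jump G n \<beta> x i j) \<noteq> 0"
    using assms unfolding arw_P_def
    by (smt (verit, best) mult_eq_0_iff of_nat_0 div_0 not_gr_zero sum.neutral)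
  then obtain j where "j \<in> verts G" "arw_move x i j = y"
    by (metis (mono_tags, lifting) mem_Collect_eq sum.neutral)
  then show thesis
    using i that[of i j "x(i := x i - 1)"] by (simp add: incr_decr arw_move_conv)
qed

text \<open>As \<open>i\<close> and \<open>j\<close> differ, a single pair of source and target
  realises this transition, and the double sum collapses to one term.\<close>

lemma arw_P_incr:
  assumes "i \<rightarrow>\<^bsub>G\<^esub> j"
  shows "arw_P G n \<beta> (incr i z) (incr j z) =
    real (Suc (z i)) / real n * (exp (\<beta> / real n) ^ z j / local_Z G (exp (\<beta> / real n)) z i)"
proof -
  have ij: "i \<in> verts G" "j \<in> verts G" "i \<noteq> j"
    using assms adj_in_verts adj_not_same by blast+
  have "arw_P G n \<beta> (incr i z) (incr j z) =
      (\<Sum>k\<in>verts G. if k = i then real (Suc (z i)) / real n * arw_jump G n \<beta> (incr i z) i j else 0)"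
    unfolding arw_P_def
  proof (rule sum.cong)
    fix k assume "k \<in> verts G"
    show "real (incr i z k) / real n *
        (\<Sum>l\<in>{l\<in>verts G. arw_move (incr i z) k l = incr j z}. arw_jump G n \<beta> (incr i z) k l) =
        (if k = i then real (Suc (z i)) / real n * arw_jump G n \<beta> (incr i z) i j else 0)"
    proof (cases "incr i z k = 0")
      case True
      then have "k \<noteq> i" by (auto simp: incr_apply)
      with True show ?thesis by simp
    next
      case False
      then have *: "{l\<in>verts G. arw_move (incr i z) k l = incr j z} = (if k = i then {j} else {})"
        using ij by (auto simp: arw_move_eq_incr_iff)
      show ?thesis unfolding * by (simp add: incr_apply)
    qed
  qed simp
  also have "\<dots> = real (Suc (z i)) / real n * arw_jump G n \<beta> (incr i z) i j"
    using ij by simp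
  also have "arw_jump G n \<beta> (incr i z) i j =
      exp (\<beta> / real n) ^ z j / local_Z G (exp (\<beta> / real n)) z i"
    using ij assms by (simp add: arw_jump_def arw_Z_incr incr_apply exp_mult_real_nat[symmetric])
  finally show ?thesis .
qed

text \<open>The \<open>Suc (z i)\<close> choices of a particle at \<open>i\<close> cancel the
  denominator from \<open>weight_incr\<close>.\<close>

lemma weight_arw_P:
  assumes "i \<rightarrow>\<^bsub>G\<^esub> j" and q: "q = exp (\<beta> / real n)"
  shows "weight (verts G) q (incr i z) * arw_P G n \<beta> (incr i z) (incr j z) =
    weight (verts G) q z * q ^ z i * q ^ z j / real n / local_Z G q z i"
proof -
  have "i \<in> verts G" using assms adj_in_verts by blast
  then show ?thesis
    by (simp add: arw_P_incr[OF assms(1)] weight_incr q[symmetric] del: of_nat_Suc)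
qed

section \<open>Reversibility on complete graphs\<close>

lemma detailed_balance_complete:
  assumes complete: "arcs_ends G = {(u, v). (u, v) \<in> verts G \<times> verts G \<and> u \<noteq> v}"
  shows "weight (verts G) (exp (\<beta> / real n)) x * arw_P G n \<beta> x y =
    weight (verts G) (exp (\<beta> / real n)) y * arw_P G n \<beta> y x"
proof -
  have local_Z: "local_Z G q z i = (\<Sum>l\<in>verts G. q ^ z l)" if "i \<in> verts G" for q z i
    unfolding local_Z_def using that by (intro sum.cong) (auto simp: complete)
  show ?thesis
  proof (cases "arw_P G n \<beta> x y = 0 \<and> arw_P G n \<beta> y x = 0")
    case False
    then obtain i j z where ij: "i \<in> verts G" "j \<in> verts G" and eq: "x = incr i z" "y = incr j z"
      by (metis arw_P_nonzeroE)
    show ?thesis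
    proof (cases "i = j")
      case False
      with ij have "i \<rightarrow>\<^bsub>G\<^esub> j" "j \<rightarrow>\<^bsub>G\<^esub> i" by (auto simp: complete)
      then show ?thesis
        by (simp add: eq weight_arw_P local_Z ij)
    qed (simp add: eq)
  qed simp
qed

lemma complete_imp_reversible:
  assumes complete: "arcs_ends G = {(u, v). (u, v) \<in> verts G \<times> verts G \<and> u \<noteq> v}"
    and "verts G \<noteq> {}" "0 < n"
  shows "reversible_chain (arw_states G n) (arw_P G n \<beta>)"
proof -
  let ?S = "arw_states G n" and ?W = "weight (verts G) (exp (\<beta> / real n))"
  define \<pi> where "\<pi> x = ?W x / sum ?W ?S" for x
  have pos: "0 < sum ?W ?S"
    using assms by (intro sum_pos finite_arw_states arw_states_nonempty weight_pos) auto
  have bal: "\<pi> x * arw_P G n \<beta> x y = \<pi> y * arw_P G n \<beta> y x" for x y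
    using detailed_balance_complete[OF complete, of \<beta> n x y] by (simp add: \<pi>_def)
  have "(\<Sum>x\<in>?S. \<pi> x * arw_P G n \<beta> x y) = \<pi> y" if "y \<in> ?S" for y
    using that assms by (simp add: bal[of _ y] sum_distrib_left[symmetric] sum_arw_P)
  moreover have "0 \<le> \<pi> x" for x
    using pos by (simp add: \<pi>_def weight_pos less_imp_le)
  moreover have "sum \<pi> ?S = 1"
    using pos by (simp add: \<pi>_def sum_divide_distrib[symmetric])
  ultimately show ?thesis
    unfolding reversible_chain_def stationary_distribution_def using bal by blast
qed

section \<open>Consequences of reversibility on connected graphs\<close>

text \<open>Here \<open>g\<close> is the density of the stationary distribution with respect to
  \<open>weight\<close>. Dividing detailed balance by the symmetric part of the flow leaves only the
  two local partition functions.\<close>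

lemma reversible_density:
  assumes "reversible_chain (arw_states G (Suc n)) (arw_P G (Suc n) \<beta>)"
    and strong: "strongly_connected G" and q: "q = exp (\<beta> / real (Suc n))"
  obtains g where "\<And>x. x \<in> arw_states G (Suc n) \<Longrightarrow> g x \<noteq> 0"
    and "\<And>z i j. z \<in> arw_states G n \<Longrightarrow> i \<rightarrow>\<^bsub>G\<^esub> j \<Longrightarrow>
      g (incr i z) * local_Z G q z j = g (incr j z) * local_Z G q z i"
proof -
  let ?S = "arw_states G (Suc n)" and ?W = "weight (verts G) q"
  have q0: "0 < q" by (simp add: q)
  obtain \<pi> where sum: "sum \<pi> ?S = 1"
    and bal: "\<And>x y. x \<in> ?S \<Longrightarrow> y \<in> ?S \<Longrightarrow>
      \<pi> x * arw_P G (Suc n) \<beta> x y = \<pi> y * arw_P G (Suc n) \<beta> y x"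
    using assms(1) unfolding reversible_chain_def stationary_distribution_def by blast
  define g where "g x = \<pi> x / ?W x" for x
  have \<pi>: "\<pi> x = g x * ?W x" for x
    using weight_pos[OF q0, of "verts G" x] by (simp add: g_def)
  have edge: "g (incr i z) * local_Z G q z j = g (incr j z) * local_Z G q z i"
    if z: "z \<in> arw_states G n" and e: "i \<rightarrow>\<^bsub>G\<^esub> j" for z i j
  proof -
    have e': "j \<rightarrow>\<^bsub>G\<^esub> i" using e by (rule graph_symmetric)
    define c where "c = ?W z * q ^ z i * q ^ z j / real (Suc n)"
    have c: "c \<noteq> 0" unfolding c_def using q0 weight_pos[OF q0, of "verts G" z] by simp
    have "incr i z \<in> ?S" "incr j z \<in> ?S"
      using z e e' adj_in_verts by (auto simp: incr_in_arw_states_iff)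
    from bal[OF this]
    have "g (incr i z) * (c / local_Z G q z i) = g (incr j z) * (c / local_Z G q z j)"
      by (simp only: \<pi> mult.assoc weight_arw_P[OF e q] weight_arw_P[OF e' q])
         (simp add: c_def mult_ac)
    then show ?thesis
      using c local_Z_pos[OF q0, of z i] local_Z_pos[OF q0, of z j]
      by (simp add: field_simps)
  qed
  \<comment> \<open>Partition functions are positive, so \<open>edge\<close> carries zeros of
    \<open>g\<close> along each edge, hence along a path from \<open>i\<close> to \<open>j\<close>.
    One zero would thus spread to all states, against total mass 1.\<close>
  have pair: "(g (incr i z) = 0) = (g (incr j z) = 0)"
    if z: "z \<in> arw_states G n" and "i \<in> verts G" "j \<in> verts G" for z i j
  proof -
    have "i \<rightarrow>\<^sup>*\<^bsub>G\<^esub> j" using strong that by blast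
    then show ?thesis
    proof (induction rule: reachable_induct)
      case (step x y)
      then show ?case
        using edge[OF z, of x y] local_Z_pos[OF q0, of z x] local_Z_pos[OF q0, of z y] by auto
    qed simp
  qed
  have nz: "g x \<noteq> 0" if "x \<in> ?S" for x
  proof
    assume "g x = 0"
    then have "g y = 0" if "y \<in> ?S" for y
      using arw_states_constant[of n "\<lambda>x. g x = 0" x y] pair that \<open>x \<in> ?S\<close> by blast
    then have "sum \<pi> ?S = 0" by (simp add: \<pi>)
    with sum show False by simp
  qed
  show thesis using that nz edge by blast
qed

text \<open>Without such a path adjacency is transitive on distinct vertices, so reachability
  reduces to equality or adjacency.\<close>

lemma ex_induced_path2:
  assumes strong: "strongly_connected G"
    and "arcs_ends G \<noteq> {(u, v). (u, v) \<in> verts G \<times> verts G \<and> u \<noteq> v}"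
  obtains (path) a b c where "a \<rightarrow>\<^bsub>G\<^esub> b" "b \<rightarrow>\<^bsub>G\<^esub> c" "a \<noteq> c" "\<not> a \<rightarrow>\<^bsub>G\<^esub> c"
proof (rule ccontr)
  assume contr: "\<not> thesis"
  have trans: "a \<rightarrow>\<^bsub>G\<^esub> c" if "a \<rightarrow>\<^bsub>G\<^esub> b" "b \<rightarrow>\<^bsub>G\<^esub> c" "a \<noteq> c" for a b c
    using contr path that by blast
  have "u = v \<or> u \<rightarrow>\<^bsub>G\<^esub> v" if "u \<rightarrow>\<^sup>*\<^bsub>G\<^esub> v" for u v
    using that by (induction rule: reachable_induct) (use trans in blast)+
  then have "arcs_ends G = {(u, v). (u, v) \<in> verts G \<times> verts G \<and> u \<noteq> v}"
    using strong adj_in_verts adj_not_same by blast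
  with assms(2) show False ..
qed

lemma reversible_imp_complete:
  assumes rev: "\<And>\<beta>. reversible_chain (arw_states G n) (arw_P G n \<beta>)"
    and strong: "strongly_connected G" and "3 \<le> n"
  shows "arcs_ends G = {(u, v). (u, v) \<in> verts G \<times> verts G \<and> u \<noteq> v}"
proof (rule ccontr)
  assume "\<not> ?thesis"
  from ex_induced_path2[OF strong this] obtain a b c where ab: "a \<rightarrow>\<^bsub>G\<^esub> b" and bc: "b \<rightarrow>\<^bsub>G\<^esub> c" and "a \<noteq> c" and nac: "\<not> a \<rightarrow>\<^bsub>G\<^esub> c"
    by blast
  have ba: "b \<rightarrow>\<^bsub>G\<^esub> a" and cb: "c \<rightarrow>\<^bsub>G\<^esub> b" and nca: "\<not> c \<rightarrow>\<^bsub>G\<^esub> a"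
    using ab bc nac graph_symmetric by blast+
  have neq: "a \<noteq> b" "b \<noteq> c" using ab bc adj_not_same by blast+
  have V: "a \<in> verts G" "b \<in> verts G" "c \<in> verts G" using ab bc adj_in_verts by blast+
  obtain m where n: "n = Suc (Suc m)" and m: "0 < m"
    using \<open>3 \<le> n\<close> by (intro that[of "n - 2"]) auto
  \<comment> \<open>No particle of \<open>u\<close> below lies in the closed neighbourhood of
    \<open>c\<close>, so \<open>?C\<close> is the size of that neighbourhood, and this choice
    ensures \<open>?C \<le> q\<close>. The value of \<open>\<beta>\<close> is solved from
    \<open>q\<close>.\<close>
  define q where "q = real (card (verts G)) + 1"
  have "0 < card (verts G)" using V by (auto simp: card_gt_0_iff)
  then have q1: "1 < q" by (simp add: q_def)
  define \<beta> where "\<beta> = real n * ln q"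
  have q: "q = exp (\<beta> / real (Suc (Suc m)))"
    using q1 by (simp add: \<beta>_def n del: of_nat_Suc)
  obtain g where g0: "\<And>x. x \<in> arw_states G n \<Longrightarrow> g x \<noteq> 0"
    and g: "\<And>z i j. z \<in> arw_states G (Suc m) \<Longrightarrow> i \<rightarrow>\<^bsub>G\<^esub> j \<Longrightarrow>
      g (incr i z) * local_Z G q z j = g (incr j z) * local_Z G q z i"
    using reversible_density[OF rev[unfolded n] strong q] n by metis
  define u where "u v = (if v = a then m else 0)" for v
  have u: "u \<in> arw_states G m"
    using V by (auto simp: arw_states_def u_def)
  let ?A = "local_Z G q u a" and ?B = "local_Z G q u b" and ?C = "local_Z G q u c"
  have "(?C + (q - 1)) * ?A * (?B + (q - 1) * q ^ m) = (?A + (q - 1)) * (?B + (q - 1)) * ?C"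
  proof -
    have z: "incr v u \<in> arw_states G (Suc m)" if "v \<in> verts G" for v
      using u that by (simp add: incr_in_arw_states_iff)
    \<comment> \<open>Corners of the square: the two travelling particles sit at
      \<open>a, b\<close>, then \<open>b, b\<close>, then \<open>b, c\<close>, then
      \<open>a, c\<close>.\<close>
    define x1 x2 x3 x4 where "x1 = g (incr a (incr b u))" "x2 = g (incr b (incr b u))"
      "x3 = g (incr c (incr b u))" "x4 = g (incr a (incr c u))"
    note x_defs = this
    have nz: "x1 \<noteq> 0" "x2 \<noteq> 0" "x3 \<noteq> 0" "x4 \<noteq> 0"
      unfolding x_defs using u V by (auto intro!: g0 simp: incr_in_arw_states_iff n)
    let ?D = "local_Z G q (incr b u) b"
    have D: "?D \<noteq> 0" using local_Z_pos[of q] q1 by (smt (verit))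
    have "x1 * ?D = x2 * (?A + (q - 1))"
      using g[OF z[OF V(2)] ab] ab neq by (simp add: x_defs local_Z_incr[of q b u a] u_def)
    moreover have "x2 * (?C + (q - 1)) = x3 * ?D"
      using g[OF z[OF V(2)] bc] cb neq by (simp add: x_defs local_Z_incr[of q b u c] u_def)
    moreover have "x3 * ?A = x4 * (?B + (q - 1))"
      using g[OF z[OF V(3)] ba] bc nac neq \<open>a \<noteq> c\<close>
      by (simp add: x_defs local_Z_incr[of q c u] u_def incr_commute[of b c])
    moreover have "x4 * (?B + (q - 1) * q ^ m) = x1 * ?C"
      \<comment> \<open>The spectator is now at \<open>a\<close>, where \<open>m\<close> particles
        already lie, so it adds \<open>(q - 1) * q ^ m\<close> to \<open>?B\<close>; on an empty
        vertex, as on the opposite side, it adds only \<open>q - 1\<close>.\<close>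
      using g[OF z[OF V(1)] cb] ba nca neq \<open>a \<noteq> c\<close>
      by (simp add: x_defs local_Z_incr[of q a u] u_def incr_commute[of _ a])
    \<comment> \<open>Multiplying the four edge identities lets the densities and \<open>?D\<close>
      cancel.\<close>
    ultimately have "(x1 * ?D) * (x2 * (?C + (q - 1))) * (x3 * ?A) * (x4 * (?B + (q - 1) * q ^ m))
        = (x2 * (?A + (q - 1))) * (x3 * ?D) * (x4 * (?B + (q - 1))) * (x1 * ?C)"
      by simp
    then have "(x1 * x2 * x3 * x4 * ?D) * ((?C + (q - 1)) * ?A * (?B + (q - 1) * q ^ m)) =
        (x1 * x2 * x3 * x4 * ?D) * ((?A + (q - 1)) * (?B + (q - 1)) * ?C)"
      by (simp only: mult_ac)
    with nz D show ?thesis by simp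
  qed
  moreover have "(?A + (q - 1)) * (?B + (q - 1)) * ?C < (?C + (q - 1)) * ?A * (?B + (q - 1) * q ^ m)"
  proof (rule cycle_inequality)
    show "1 < q" by fact
    show "q \<le> q ^ m" using q1 m by (simp add: self_le_power)
    show "0 < ?B" "0 < ?C" using q1 by (simp_all add: local_Z_pos)
    have "?C = real (card (insert c {l. c \<rightarrow>\<^bsub>G\<^esub> l}))"
      unfolding local_Z_def using nca \<open>a \<noteq> c\<close> by (subst sum.cong[OF refl, of _ _ "\<lambda>_. 1"]) (auto simp: u_def)
    also have "\<dots> \<le> real (card (verts G))"
      using V adj_in_verts by (intro of_nat_mono card_mono) auto
    finally show "?C \<le> q" by (simp add: q_def)
    have "q ^ u a \<le> ?A"
      unfolding local_Z_def using q1 by (intro member_le_sum) (auto simp: finite_neighbours)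
    then show "q ^ m \<le> ?A" by (simp add: u_def)
  qed
  ultimately show False by simp
qed

end

theorem theorem3:
  fixes G :: "('a, 'b) pre_digraph" and n :: nat
  assumes "graph G"
    and "Digraph_Component.connected G"
    and "n \<ge> 3"
  shows "(\<forall>\<beta>::real. reversible_chain (arw_states G n) (arw_P G n \<beta>)) \<longleftrightarrow>
         complete_digraph (card (verts G)) G"
proof -
  interpret graph G by fact
  have strong: "strongly_connected G"
    using symmetric_connected_imp_strongly_connected sym_arcs assms(2) by blast
  then have "verts G \<noteq> {}" by (simp add: strongly_connected_def)
  then show ?thesis
    using reversible_imp_complete[OF _ strong assms(3)] complete_imp_reversible assms
    by (auto simp: complete_digraph_def)
qed

end
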